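(* For all positive integers $n$, the immaculate algebra $$\mathbb{C}\mathcal{I}_n = \bigoplus_{\alpha \vDash n} \mathcal{M}_{g^{\alpha}}(\mathbb{C})$$ has the structure of a monoid algebra; that is, there exists a monoid $M$ such that $\mathbb{C}\mathcal{I}_n$ is isomorphic, as a $\mathbb{C}$-algebra, to the monoid algebra $\mathbb{C}M$ (equivalently, $\mathbb{C}\mathcal{I}_n$ has a $\mathbb{C}$-basis that is a monoid under the multiplication of $\mathbb{C}\mathcal{I}_n$).
   Context: $\mathcal{M}_m(\mathbb{C})$ denotes the algebra of $m \times m$ complex matrices. A composition $\alpha = (\alpha_1, \ldots, \alpha_{\ell(\alpha)})$ of a positive integer $n$, written $\alpha \vDash n$, is a finite tuple of positive integers with sum $n$. The diagram of $\alpha$ has $\ell(\alpha)$ left-justified rows, the $i$-th row having $\alpha_i$ cells. A standard immaculate tableau of shape $\alpha \vDash n$ is a filling of the cells of this diagram with the labels $1, 2, \ldots, n$, each used exactly once, such that each row is increasing when read from left to right and the first (leftmost) column is strictly increasing when read from the first row to the last row (no condition is imposed on the other columns). The number of standard immaculate tableaux of shape $\alpha$ is denoted $g^{\alpha}$. The direct sum is over all compositions of $n$, with componentwise operations. A monoid is a set with an associative binary operation and an identity element; the monoid algebra $\mathbb{C}M$ is the $\mathbb{C}$-vector space with basis $M$ and multiplication extending that of $M$ bilinearly. *)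

theory Defs
  imports "Jordan_Normal_Form.Matrix" "HOL-Algebra.QuotRing"
begin

section \<open>Complex algebras and their isomorphisms\<close>

text \<open>
  The locale \<open>algebra\<close> of the library covers commutative algebras only.  A complex algebra that
  need not be commutative is represented here by a record of type \<open>(complex, 'b) module\<close>, which
  carries the ring operations and the scalar multiplication, all scalars being admissible.
\<close>

definition complex_algebra_iso ::
  "(complex, 'b, 'm) module_scheme \<Rightarrow> (complex, 'c, 'n) module_scheme \<Rightarrow> ('b \<Rightarrow> 'c) set" where
  "complex_algebra_iso A B =
     {h \<in> ring_iso A B. \<forall>c. \<forall>x \<in> carrier A. h (c \<odot>\<^bsub>A\<^esub> x) = c \<odot>\<^bsub>B\<^esub> h x}"

definition is_complex_algebra_iso ::
  "(complex, 'b, 'm) module_scheme \<Rightarrow> (complex, 'c, 'n) module_scheme \<Rightarrow> bool" where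
  "is_complex_algebra_iso A B \<longleftrightarrow> complex_algebra_iso A B \<noteq> {}"

text \<open>
  Componentwise operations on families.  This is the direct product, hence the direct sum only if
  the index set is finite, which is the only case used below.
\<close>

definition finite_direct_sum ::
  "'i set \<Rightarrow> ('i \<Rightarrow> (complex, 'b) module) \<Rightarrow> (complex, 'i \<Rightarrow> 'b) module" where
  "finite_direct_sum I A = \<lparr>
     carrier = (\<Pi>\<^sub>E i\<in>I. carrier (A i)),
     mult = (\<lambda>x y. \<lambda>i\<in>I. x i \<otimes>\<^bsub>A i\<^esub> y i),
     one = (\<lambda>i\<in>I. \<one>\<^bsub>A i\<^esub>),
     zero = (\<lambda>i\<in>I. \<zero>\<^bsub>A i\<^esub>),
     add = (\<lambda>x y. \<lambda>i\<in>I. x i \<oplus>\<^bsub>A i\<^esub> y i),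
     smult = (\<lambda>c x. \<lambda>i\<in>I. c \<odot>\<^bsub>A i\<^esub> x i)\<rparr>"

text \<open>
  Elements of the monoid algebra are the finitely supported coefficient functions on the monoid;
  the function with value \<open>1\<close> at \<open>x\<close> and \<open>0\<close> elsewhere is the basis vector \<open>x\<close>, and the
  multiplication (convolution) is the bilinear extension of the one of the monoid.
\<close>

definition monoid_algebra :: "('a, 'm) monoid_scheme \<Rightarrow> (complex, 'a \<Rightarrow> complex) module" where
  "monoid_algebra M = \<lparr>
     carrier = {f. finite {x. f x \<noteq> 0} \<and> {x. f x \<noteq> 0} \<subseteq> carrier M},
     mult = (\<lambda>f g z. \<Sum>x | f x \<noteq> 0. \<Sum>y | g y \<noteq> 0. if x \<otimes>\<^bsub>M\<^esub> y = z then f x * g y else 0),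
     one = (\<lambda>z. if z = \<one>\<^bsub>M\<^esub> then 1 else 0),
     zero = (\<lambda>z. 0),
     add = (\<lambda>f g z. f z + g z),
     smult = (\<lambda>c f z. c * f z)\<rparr>"

section \<open>Standard immaculate tableaux\<close>

definition compositions :: "nat \<Rightarrow> nat list set" where
  "compositions n = {\<alpha>. sum_list \<alpha> = n \<and> (\<forall>a \<in> set \<alpha>. a > 0)}"

text \<open>Cells are pairs (row, column), both counted from \<open>0\<close>.\<close>

definition diagram :: "nat list \<Rightarrow> (nat \<times> nat) set" where
  "diagram \<alpha> = {(i, j). i < length \<alpha> \<and> j < \<alpha> ! i}"

definition standard_immaculate_tableaux :: "nat list \<Rightarrow> (nat \<times> nat \<Rightarrow> nat) set" where
  "standard_immaculate_tableaux \<alpha> =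
     {T \<in> extensional (diagram \<alpha>).
        bij_betw T (diagram \<alpha>) {1..sum_list \<alpha>} \<and>
        (\<forall>i j k. (i, j) \<in> diagram \<alpha> \<longrightarrow> (i, k) \<in> diagram \<alpha> \<longrightarrow> j < k \<longrightarrow> T (i, j) < T (i, k)) \<and>
        (\<forall>i k. (i, 0) \<in> diagram \<alpha> \<longrightarrow> (k, 0) \<in> diagram \<alpha> \<longrightarrow> i < k \<longrightarrow> T (i, 0) < T (k, 0))}"

definition num_immaculate :: "nat list \<Rightarrow> nat" where
  "num_immaculate \<alpha> = card (standard_immaculate_tableaux \<alpha>)"

section \<open>The immaculate algebra\<close>

definition immaculate_algebra :: "nat \<Rightarrow> (complex, nat list \<Rightarrow> complex mat) module" where
  "immaculate_algebra n =
     finite_direct_sum (compositions n)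
       (\<lambda>\<alpha>. module_mat TYPE(complex) (num_immaculate \<alpha>) (num_immaculate \<alpha>))"

end

theory Submission
  imports Defs "HOL-Library.Countable" "HOL-Algebra.Weak_Morphisms"
begin

text \<open>
  Matrix units multiply to matrix units or to zero, so the matrix units of all blocks of a direct sum
  of matrix algebras are a basis that fails to be a monoid for two reasons only: the product
  \<open>0\<close> is not a basis vector, and neither is the identity.  Two blocks of dimension one,
  with indices \<open>a\<close> and \<open>b\<close>, repair both.  Write \<open>e\<close> for the matrix unit
  of block \<open>a\<close>, and exchange the basis vectors as follows: keep \<open>e\<close>; replace the
  matrix unit of block \<open>b\<close> by the identity of the whole algebra; replace every other matrix unit
  \<open>E\<close> by \<open>E + e\<close>.  As \<open>e\<close> is a central idempotent orthogonal to the other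
  blocks, \<open>(E + e) (F + e) = E F + e\<close>, so \<open>e\<close> now plays the role of the zero, and
  the new vectors form a monoid.  They still form a basis: subtracting \<open>e\<close> recovers the
  matrix units outside \<open>a\<close> and \<open>b\<close>, and then the identity yields the unit of block
  \<open>b\<close>.

  The immaculate algebra has two such blocks as soon as \<open>n > 1\<close>: the shapes \<open>(n)\<close> and
  \<open>(1, ..., 1)\<close> have one standard immaculate tableau each (\<open>num_immaculate_row\<close>,
  \<open>num_immaculate_column\<close>).  For \<open>n = 1\<close> the two shapes coincide and the algebra is
  \<open>\<complex>\<close>, the algebra of the trivial monoid; the same formulas cover this case.

  The isomorphism is written in the direction from the monoid algebra to the direct sum, as the linear
  extension of a family of matrix representations of the monoid, one for each block.
  Multiplicativity of such a linear extension is general (\<open>linear_extension_iso\<close>); what remains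
  is that the given matrices are representations (\<open>unit_rep_mult\<close>) and that the linear system
  expressing the new basis in terms of the matrix units is uniquely solvable
  (\<open>linear_extension_unit_rep_bij\<close>).
\<close>

section \<open>Isomorphisms of complex algebras\<close>

lemma complex_algebra_iso_trans:
  assumes "f \<in> complex_algebra_iso A B" and "g \<in> complex_algebra_iso B C"
  shows "g \<circ> f \<in> complex_algebra_iso A C"
  using assms ring_iso_set_trans[of f A B g C] ring_iso_memE(1)[of f A B]
  by (auto simp: complex_algebra_iso_def)

text \<open>
  The records need not satisfy any ring axioms, so the closure of the domain under its operations is
  what lets the inverse be computed on them.
\<close>

lemma complex_algebra_iso_sym:
  assumes h: "h \<in> complex_algebra_iso A B"
    and one: "\<one>\<^bsub>A\<^esub> \<in> carrier A"
    and mult: "\<And>x y. x \<in> carrier A \<Longrightarrow> y \<in> carrier A \<Longrightarrow> x \<otimes>\<^bsub>A\<^esub> y \<in> carrier A"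
    and add: "\<And>x y. x \<in> carrier A \<Longrightarrow> y \<in> carrier A \<Longrightarrow> x \<oplus>\<^bsub>A\<^esub> y \<in> carrier A"
    and smult: "\<And>c x. x \<in> carrier A \<Longrightarrow> c \<odot>\<^bsub>A\<^esub> x \<in> carrier A"
  shows "inv_into (carrier A) h \<in> complex_algebra_iso B A"
proof -
  let ?g = "inv_into (carrier A) h"
  have iso: "h \<in> ring_iso A B"
    and lin: "\<And>c x. x \<in> carrier A \<Longrightarrow> h (c \<odot>\<^bsub>A\<^esub> x) = c \<odot>\<^bsub>B\<^esub> h x"
    using h by (auto simp: complex_algebra_iso_def)
  note hom = ring_iso_memE[OF iso]
  have inj: "inj_on h (carrier A)"
    using hom(5) by (rule bij_betw_imp_inj_on)
  have g: "?g y \<in> carrier A" "h (?g y) = y" if "y \<in> carrier B" for y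
    using hom(5) that by (auto simp: bij_betw_inv_into_right bij_betw_def inv_into_into)
  have unique: "?g y = x" if "x \<in> carrier A" "h x = y" for x y
    using inj that by (auto simp: inv_into_f_eq)
  have "?g \<in> ring_iso B A"
    by (rule ring_iso_memI)
      (auto simp: g hom one mult add intro!: unique bij_betw_inv_into)
  moreover have "?g (c \<odot>\<^bsub>B\<^esub> y) = c \<odot>\<^bsub>A\<^esub> ?g y" if "y \<in> carrier B" for c y
    using that by (auto simp: g lin smult intro!: unique)
  ultimately show ?thesis
    by (simp add: complex_algebra_iso_def)
qed

section \<open>Monoid algebras of finite monoids\<close>

lemma monoid_algebra_carrier_finite:
  assumes "finite (carrier M)"
  shows "carrier (monoid_algebra M) = {f. \<forall>x. x \<notin> carrier M \<longrightarrow> f x = 0}"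
  using assms by (auto simp: monoid_algebra_def intro: finite_subset)

text \<open>
  Summing over the whole monoid instead of over the supports makes the index sets independent of the
  two factors, so that sums can be exchanged and reindexed.
\<close>

lemma monoid_algebra_mult_finite:
  assumes fin: "finite (carrier M)"
    and f: "f \<in> carrier (monoid_algebra M)" and g: "g \<in> carrier (monoid_algebra M)"
  shows "(f \<otimes>\<^bsub>monoid_algebra M\<^esub> g) z =
    (\<Sum>x\<in>carrier M. \<Sum>y\<in>carrier M. if x \<otimes>\<^bsub>M\<^esub> y = z then f x * g y else 0)"
proof -
  have "(\<Sum>x | f x \<noteq> 0. \<Sum>y | g y \<noteq> 0. if x \<otimes>\<^bsub>M\<^esub> y = z then f x * g y else 0) =
    (\<Sum>x | f x \<noteq> 0. \<Sum>y\<in>carrier M. if x \<otimes>\<^bsub>M\<^esub> y = z then f x * g y else 0)"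
    using fin g by (intro sum.cong refl sum.mono_neutral_left) (auto simp: monoid_algebra_def)
  also have "\<dots> = (\<Sum>x\<in>carrier M. \<Sum>y\<in>carrier M. if x \<otimes>\<^bsub>M\<^esub> y = z then f x * g y else 0)"
    using fin f by (intro sum.mono_neutral_left ballI sum.neutral) (auto simp: monoid_algebra_def)
  finally show ?thesis by (simp add: monoid_algebra_def)
qed

lemma monoid_algebra_closed:
  assumes M: "monoid M" and fin: "finite (carrier M)"
  shows "\<one>\<^bsub>monoid_algebra M\<^esub> \<in> carrier (monoid_algebra M)"
    and "f \<in> carrier (monoid_algebra M) \<Longrightarrow> g \<in> carrier (monoid_algebra M) \<Longrightarrow>
      f \<otimes>\<^bsub>monoid_algebra M\<^esub> g \<in> carrier (monoid_algebra M)"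
    and "f \<in> carrier (monoid_algebra M) \<Longrightarrow> g \<in> carrier (monoid_algebra M) \<Longrightarrow>
      f \<oplus>\<^bsub>monoid_algebra M\<^esub> g \<in> carrier (monoid_algebra M)"
    and "f \<in> carrier (monoid_algebra M) \<Longrightarrow> c \<odot>\<^bsub>monoid_algebra M\<^esub> f \<in> carrier (monoid_algebra M)"
proof -
  interpret monoid M by (rule M)
  note carr = monoid_algebra_carrier_finite[OF fin]
  show "\<one>\<^bsub>monoid_algebra M\<^esub> \<in> carrier (monoid_algebra M)"
    by (simp add: carr) (auto simp: monoid_algebra_def)
  show "f \<in> carrier (monoid_algebra M) \<Longrightarrow> g \<in> carrier (monoid_algebra M) \<Longrightarrow>
      f \<oplus>\<^bsub>monoid_algebra M\<^esub> g \<in> carrier (monoid_algebra M)"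
    by (simp add: carr) (simp add: monoid_algebra_def)
  show "f \<in> carrier (monoid_algebra M) \<Longrightarrow> c \<odot>\<^bsub>monoid_algebra M\<^esub> f \<in> carrier (monoid_algebra M)"
    by (simp add: carr) (simp add: monoid_algebra_def)
  assume f: "f \<in> carrier (monoid_algebra M)" and g: "g \<in> carrier (monoid_algebra M)"
  have "(f \<otimes>\<^bsub>monoid_algebra M\<^esub> g) z = 0" if "z \<notin> carrier M" for z
    unfolding monoid_algebra_mult_finite[OF fin f g]
    using that by (intro sum.neutral ballI) auto
  then show "f \<otimes>\<^bsub>monoid_algebra M\<^esub> g \<in> carrier (monoid_algebra M)"
    by (simp add: carr)
qed

text \<open>
  Used to move from a monoid whose elements are triples to a copy of it on the natural numbers.
  Pulling coefficient functions back along \<open>e\<close> is why the isomorphism runs against \<open>e\<close>.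
\<close>

lemma monoid_algebra_iso_of_monoid_iso:
  assumes M: "monoid M" and fin: "finite (carrier M)"
    and e: "e \<in> iso M N" and e_one: "e \<one>\<^bsub>M\<^esub> = \<one>\<^bsub>N\<^esub>"
  shows "(\<lambda>g x. if x \<in> carrier M then g (e x) else 0) \<in>
    complex_algebra_iso (monoid_algebra N) (monoid_algebra M)"
proof -
  interpret monoid M by (rule M)
  let ?h = "\<lambda>g x. if x \<in> carrier M then g (e x) else (0 :: complex)"
  have inj: "inj_on e (carrier M)" and img: "e ` carrier M = carrier N"
    and hom: "\<And>x y. x \<in> carrier M \<Longrightarrow> y \<in> carrier M \<Longrightarrow> e (x \<otimes>\<^bsub>M\<^esub> y) = e x \<otimes>\<^bsub>N\<^esub> e y"
    using e by (auto simp: iso_def hom_def bij_betw_def)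
  have finN: "finite (carrier N)" using fin img by (metis finite_imageI)
  note carrM = monoid_algebra_carrier_finite[OF fin] and carrN = monoid_algebra_carrier_finite[OF finN]
  have "?h \<in> ring_iso (monoid_algebra N) (monoid_algebra M)"
  proof (rule ring_iso_memI)
    fix f g assume f: "f \<in> carrier (monoid_algebra N)" and g: "g \<in> carrier (monoid_algebra N)"
    show hf: "?h f \<in> carrier (monoid_algebra M)"
      by (simp add: carrM)
    show "?h (f \<oplus>\<^bsub>monoid_algebra N\<^esub> g) = ?h f \<oplus>\<^bsub>monoid_algebra M\<^esub> ?h g"
      by (auto simp: monoid_algebra_def)
    have hg: "?h g \<in> carrier (monoid_algebra M)"
      by (simp add: carrM)
    have "(f \<otimes>\<^bsub>monoid_algebra N\<^esub> g) (e z) =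
      (\<Sum>x\<in>carrier M. \<Sum>y\<in>carrier M. if x \<otimes>\<^bsub>M\<^esub> y = z then ?h f x * ?h g y else 0)"
      if z: "z \<in> carrier M" for z
      unfolding monoid_algebra_mult_finite[OF finN f g] img[symmetric]
        sum.reindex[OF inj] o_def
      using z by (intro sum.cong refl) (auto simp: hom[symmetric] inj_on_eq_iff[OF inj])
    then have "?h (f \<otimes>\<^bsub>monoid_algebra N\<^esub> g) z = (?h f \<otimes>\<^bsub>monoid_algebra M\<^esub> ?h g) z" for z
      using monoid_algebra_closed(2)[OF M fin hf hg]
      by (cases "z \<in> carrier M") (simp_all add: monoid_algebra_mult_finite[OF fin hf hg] carrM)
    then show "?h (f \<otimes>\<^bsub>monoid_algebra N\<^esub> g) = ?h f \<otimes>\<^bsub>monoid_algebra M\<^esub> ?h g"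
      by (rule ext)
  next
    show "?h \<one>\<^bsub>monoid_algebra N\<^esub> = \<one>\<^bsub>monoid_algebra M\<^esub>"
      by (auto simp: monoid_algebra_def e_one[symmetric] inj_on_eq_iff[OF inj])
  next
    let ?k = "\<lambda>f y. if y \<in> carrier N then f (inv_into (carrier M) e y) else (0 :: complex)"
    show "bij_betw ?h (carrier (monoid_algebra N)) (carrier (monoid_algebra M))"
      by (rule bij_betw_byWitness[where f' = ?k])
        (auto simp: carrM carrN img[symmetric] fun_eq_iff f_inv_into_f inv_into_f_f[OF inj])
  qed
  then show ?thesis
    by (auto simp: complex_algebra_iso_def monoid_algebra_def)
qed

lemma monoid_image_group:
  assumes M: "monoid M" and inj: "inj_on e (carrier M)"
  shows "monoid (image_group e M)" and "e \<in> iso M (image_group e M)"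
proof -
  interpret monoid M by (rule M)
  show "monoid (image_group e M)"
    by unfold_locales (auto simp: image_group_def inv_into_f_f[OF inj] m_assoc)
  show "e \<in> iso M (image_group e M)"
    using inj by (auto simp: iso_def hom_def bij_betw_def image_group_def inv_into_f_f[OF inj])
qed

section \<open>Families of matrix representations\<close>

definition linear_extension ::
  "'i set \<Rightarrow> ('i \<Rightarrow> nat) \<Rightarrow> ('i \<Rightarrow> 'a \<Rightarrow> complex mat) \<Rightarrow> ('a, 'm) monoid_scheme \<Rightarrow>
    ('a \<Rightarrow> complex) \<Rightarrow> 'i \<Rightarrow> complex mat" where
  "linear_extension I d \<rho> M f =
    (\<lambda>i\<in>I. mat (d i) (d i) (\<lambda>(r, s). \<Sum>x\<in>carrier M. f x * \<rho> i x $$ (r, s)))"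

abbreviation matrix_sum :: "'i set \<Rightarrow> ('i \<Rightarrow> nat) \<Rightarrow> (complex, 'i \<Rightarrow> complex mat) module" where
  "matrix_sum I d \<equiv> finite_direct_sum I (\<lambda>i. module_mat TYPE(complex) (d i) (d i))"

text \<open>
  Multiplicativity on basis vectors extends bilinearly: both sides of the product rule are the sum of
  \<open>f x * g y\<close> times the matrix of \<open>x\<close> times the matrix of \<open>y\<close>.
\<close>

lemma linear_extension_iso:
  assumes M: "monoid M" and fin: "finite (carrier M)"
    and dim: "\<And>i x. i \<in> I \<Longrightarrow> x \<in> carrier M \<Longrightarrow> \<rho> i x \<in> carrier_mat (d i) (d i)"
    and mult: "\<And>i x y. i \<in> I \<Longrightarrow> x \<in> carrier M \<Longrightarrow> y \<in> carrier M \<Longrightarrow>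
      \<rho> i (x \<otimes>\<^bsub>M\<^esub> y) = \<rho> i x * \<rho> i y"
    and one: "\<And>i. i \<in> I \<Longrightarrow> \<rho> i \<one>\<^bsub>M\<^esub> = 1\<^sub>m (d i)"
    and bij: "bij_betw (linear_extension I d \<rho> M) (carrier (monoid_algebra M))
      (carrier (matrix_sum I d))"
  shows "linear_extension I d \<rho> M \<in> complex_algebra_iso (monoid_algebra M) (matrix_sum I d)"
proof -
  interpret monoid M by (rule M)
  let ?\<Phi> = "linear_extension I d \<rho> M"
  note defs = linear_extension_def finite_direct_sum_def module_mat_simps
  have "?\<Phi> \<in> ring_iso (monoid_algebra M) (matrix_sum I d)"
  proof (rule ring_iso_memI)
    fix f g assume f: "f \<in> carrier (monoid_algebra M)" and g: "g \<in> carrier (monoid_algebra M)"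
    show "?\<Phi> f \<in> carrier (matrix_sum I d)"
      using bij f by (rule bij_betw_apply)
    show "?\<Phi> (f \<oplus>\<^bsub>monoid_algebra M\<^esub> g) = ?\<Phi> f \<oplus>\<^bsub>matrix_sum I d\<^esub> ?\<Phi> g"
      by (auto simp: defs monoid_algebra_def distrib_right sum.distrib
          intro!: restrict_ext eq_matI)
    have entry: "(\<Sum>z\<in>carrier M. (f \<otimes>\<^bsub>monoid_algebra M\<^esub> g) z * \<rho> i z $$ (r, s)) =
        (\<Sum>t<d i. (\<Sum>x\<in>carrier M. f x * \<rho> i x $$ (r, t)) * (\<Sum>y\<in>carrier M. g y * \<rho> i y $$ (t, s)))"
      if i: "i \<in> I" and rs: "r < d i" "s < d i" for i r s
    proof -
      \<comment> \<open>For fixed factors the convolution contributes only at their product, so the sum over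
        the value of the product is taken first; the sum over the inner matrix index is moved
        outside last.\<close>
      have "(\<Sum>z\<in>carrier M. (f \<otimes>\<^bsub>monoid_algebra M\<^esub> g) z * \<rho> i z $$ (r, s)) =
        (\<Sum>z\<in>carrier M. \<Sum>x\<in>carrier M. \<Sum>y\<in>carrier M.
          if z = x \<otimes>\<^bsub>M\<^esub> y then f x * g y * \<rho> i z $$ (r, s) else 0)"
        unfolding monoid_algebra_mult_finite[OF fin f g] sum_distrib_right
        by (intro sum.cong refl) auto
      also have "\<dots> = (\<Sum>x\<in>carrier M. \<Sum>z\<in>carrier M. \<Sum>y\<in>carrier M.
          if z = x \<otimes>\<^bsub>M\<^esub> y then f x * g y * \<rho> i z $$ (r, s) else 0)"
        by (rule sum.swap)
      also have "\<dots> = (\<Sum>x\<in>carrier M. \<Sum>y\<in>carrier M. \<Sum>z\<in>carrier M.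
          if z = x \<otimes>\<^bsub>M\<^esub> y then f x * g y * \<rho> i z $$ (r, s) else 0)"
        by (intro sum.cong refl sum.swap)
      also have "\<dots> = (\<Sum>x\<in>carrier M. \<Sum>y\<in>carrier M. f x * g y * \<rho> i (x \<otimes>\<^bsub>M\<^esub> y) $$ (r, s))"
        using fin by (intro sum.cong refl) (simp add: sum.delta)
      also have "\<dots> = (\<Sum>x\<in>carrier M. \<Sum>y\<in>carrier M. \<Sum>t<d i.
          (f x * \<rho> i x $$ (r, t)) * (g y * \<rho> i y $$ (t, s)))"
      proof (intro sum.cong refl)
        fix x y assume xy: "x \<in> carrier M" "y \<in> carrier M"
        have "\<rho> i (x \<otimes>\<^bsub>M\<^esub> y) $$ (r, s) = (\<Sum>t<d i. \<rho> i x $$ (r, t) * \<rho> i y $$ (t, s))"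
          using dim[OF i xy(1)] dim[OF i xy(2)] rs
          by (simp add: mult[OF i xy] scalar_prod_def lessThan_atLeast0)
        then show "f x * g y * \<rho> i (x \<otimes>\<^bsub>M\<^esub> y) $$ (r, s) =
            (\<Sum>t<d i. (f x * \<rho> i x $$ (r, t)) * (g y * \<rho> i y $$ (t, s)))"
          by (simp add: sum_distrib_left mult_ac)
      qed
      also have "\<dots> = (\<Sum>x\<in>carrier M. \<Sum>t<d i. \<Sum>y\<in>carrier M.
          (f x * \<rho> i x $$ (r, t)) * (g y * \<rho> i y $$ (t, s)))"
        by (intro sum.cong refl sum.swap)
      also have "\<dots> = (\<Sum>t<d i. \<Sum>x\<in>carrier M. \<Sum>y\<in>carrier M.
          (f x * \<rho> i x $$ (r, t)) * (g y * \<rho> i y $$ (t, s)))"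
        by (rule sum.swap)
      finally show ?thesis
        by (simp add: sum_product)
    qed
    show "?\<Phi> (f \<otimes>\<^bsub>monoid_algebra M\<^esub> g) = ?\<Phi> f \<otimes>\<^bsub>matrix_sum I d\<^esub> ?\<Phi> g"
      by (auto simp: defs entry scalar_prod_def lessThan_atLeast0 intro!: restrict_ext eq_matI)
  next
    have "(\<Sum>x\<in>carrier M. \<one>\<^bsub>monoid_algebra M\<^esub> x * \<rho> i x $$ (r, s)) = \<rho> i \<one>\<^bsub>M\<^esub> $$ (r, s)" for i r s
      using fin by (simp add: monoid_algebra_def sum.delta if_distrib[of "\<lambda>c. c * _"] cong: if_cong)
    then show "?\<Phi> \<one>\<^bsub>monoid_algebra M\<^esub> = \<one>\<^bsub>matrix_sum I d\<^esub>"
      by (auto simp: defs one intro!: restrict_ext eq_matI)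
  qed (rule bij)
  moreover have "?\<Phi> (c \<odot>\<^bsub>monoid_algebra M\<^esub> f) = c \<odot>\<^bsub>matrix_sum I d\<^esub> ?\<Phi> f" for c f
    by (auto simp: defs monoid_algebra_def sum_distrib_left mult.assoc intro!: restrict_ext eq_matI)
  ultimately show ?thesis
    by (simp add: complex_algebra_iso_def)
qed

section \<open>The monoid of matrix units\<close>

definition matrix_units :: "'i set \<Rightarrow> ('i \<Rightarrow> nat) \<Rightarrow> ('i \<times> nat \<times> nat) set" where
  "matrix_units I d = {(i, r, s). i \<in> I \<and> r < d i \<and> s < d i}"

text \<open>
  The triple \<open>(b, 0, 0)\<close> stands for the identity, \<open>(a, 0, 0)\<close> for the zero, and the
  other triples for the matrix units they name; blocks \<open>a\<close> and \<open>b\<close> have dimension one, so each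
  contributes exactly one triple.  The last two clauses make \<open>(a, 0, 0)\<close> absorbing: it is idempotent
  as a matrix unit of block \<open>a\<close>, and a mismatched product, in particular one of matrix units from
  different blocks, is \<open>(a, 0, 0)\<close>.
\<close>

fun unit_mult :: "'i \<Rightarrow> 'i \<Rightarrow> 'i \<times> nat \<times> nat \<Rightarrow> 'i \<times> nat \<times> nat \<Rightarrow> 'i \<times> nat \<times> nat" where
  "unit_mult a b (i, r, s) (j, t, u) =
    (if (i, r, s) = (b, 0, 0) then (j, t, u)
     else if (j, t, u) = (b, 0, 0) then (i, r, s)
     else if i = j \<and> s = t then (i, r, u)
     else (a, 0, 0))"

definition unit_monoid :: "'i set \<Rightarrow> ('i \<Rightarrow> nat) \<Rightarrow> 'i \<Rightarrow> 'i \<Rightarrow> ('i \<times> nat \<times> nat) monoid" where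
  "unit_monoid I d a b =
    \<lparr>carrier = matrix_units I d, mult = unit_mult a b, one = (b, 0, 0)\<rparr>"

text \<open>
  The component in block \<open>i\<close> of the basis vector for \<open>x\<close>.  Block \<open>a\<close> carries the trivial
  representation, since every basis vector contains the matrix unit of \<open>a\<close> with coefficient one.
  Block \<open>b\<close> carries the indicator of the identity.  In the other blocks \<open>x\<close> acts as the matrix unit
  it names, the identity acts as the identity matrix, and everything else acts as zero.
\<close>

definition unit_rep :: "('i \<Rightarrow> nat) \<Rightarrow> 'i \<Rightarrow> 'i \<Rightarrow> 'i \<Rightarrow> 'i \<times> nat \<times> nat \<Rightarrow> complex mat" where
  "unit_rep d a b i x = mat (d i) (d i)
    (\<lambda>(r, s). of_bool (i = a \<or> x = (i, r, s) \<or> x = (b, 0, 0) \<and> r = s))"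

text \<open>
  Two one-dimensional blocks, or a single block of dimension one, in which case the construction
  yields the trivial monoid.
\<close>

locale two_characters =
  fixes I :: "'i set" and d :: "'i \<Rightarrow> nat" and a b :: 'i
  assumes finite_index: "finite I"
    and a: "a \<in> I" "d a = 1"
    and b: "b \<in> I" "d b = 1"
    and distinct_or_only: "a \<noteq> b \<or> I = {a}"
begin

lemma finite_matrix_units: "finite (matrix_units I d)"
proof -
  have "matrix_units I d = (SIGMA i:I. {..<d i} \<times> {..<d i})"
    by (auto simp: matrix_units_def)
  then show ?thesis using finite_index by simp
qed

lemma unit_mult_one: "unit_mult a b (b, 0, 0) x = x" "unit_mult a b x (b, 0, 0) = x"
  by (cases x; simp)+

text \<open>
  Block \<open>b\<close> contains nothing but the identity, and if \<open>a = b\<close> then there is nothing but the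
  identity at all.
\<close>

lemma unit_not_one:
  assumes "(i, r, s) \<in> matrix_units I d" and "(i, r, s) \<noteq> (b, 0, 0)"
  shows "i \<noteq> b" and "a \<noteq> b"
  using assms a b distinct_or_only by (auto simp: matrix_units_def)

lemma unit_mult_closed:
  assumes "x \<in> matrix_units I d" and "y \<in> matrix_units I d"
  shows "unit_mult a b x y \<in> matrix_units I d"
  using assms a b by (cases x; cases y) (auto simp: matrix_units_def)

lemma unit_mult_assoc:
  assumes x: "x \<in> matrix_units I d" and y: "y \<in> matrix_units I d" and z: "z \<in> matrix_units I d"
  shows "unit_mult a b (unit_mult a b x y) z = unit_mult a b x (unit_mult a b y z)"
proof (cases "x = (b, 0, 0) \<or> y = (b, 0, 0) \<or> z = (b, 0, 0)")
  case True
  then show ?thesis by (auto simp: unit_mult_one)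
next
  case False
  obtain i r s j t u k v w where eqs: "x = (i, r, s)" "y = (j, t, u)" "z = (k, v, w)"
    by (cases x, cases y, cases z)
  have "i \<noteq> b" "j \<noteq> b" "k \<noteq> b" "a \<noteq> b"
    using False unit_not_one x y z unfolding eqs by blast+
  moreover have "i = a \<Longrightarrow> r = 0 \<and> s = 0" "j = a \<Longrightarrow> t = 0 \<and> u = 0" "k = a \<Longrightarrow> v = 0 \<and> w = 0"
    using x y z a by (auto simp: eqs matrix_units_def)
  ultimately show ?thesis
    by (simp add: eqs)
qed

lemma unit_monoid: "monoid (unit_monoid I d a b)"
  using b by unfold_locales
    (auto simp: unit_monoid_def unit_mult_one unit_mult_closed unit_mult_assoc
      simp del: unit_mult.simps, simp add: matrix_units_def)

lemma unit_rep_one: "i \<in> I \<Longrightarrow> unit_rep d a b i (b, 0, 0) = 1\<^sub>m (d i)"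
  using a by (auto simp: unit_rep_def intro!: eq_matI)

text \<open>
  Outside block \<open>a\<close> and away from the identity this is the multiplication rule of matrix units.  A
  mismatched product is sent to zero there because \<open>(a, 0, 0)\<close> names no matrix unit of such a block.
\<close>

lemma unit_rep_mult:
  assumes i: "i \<in> I" and x: "x \<in> matrix_units I d" and y: "y \<in> matrix_units I d"
  shows "unit_rep d a b i (unit_mult a b x y) = unit_rep d a b i x * unit_rep d a b i y"
proof -
  have dim: "unit_rep d a b i z \<in> carrier_mat (d i) (d i)" for z
    by (simp add: unit_rep_def)
  consider "x = (b, 0, 0)" | "y = (b, 0, 0)" | "i = a" |
    (units) "x \<noteq> (b, 0, 0)" "y \<noteq> (b, 0, 0)" "i \<noteq> a"
    by blast
  then show ?thesis
  proof cases
    case 1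
    then show ?thesis using i dim[of y] by (cases y) (simp add: unit_rep_one)
  next
    case 2
    then show ?thesis using i dim[of x] by (cases x) (auto simp add: unit_rep_one)
  next
    case 3
    then show ?thesis using a by (auto simp: unit_rep_def scalar_prod_def intro!: eq_matI)
  next
    case units
    obtain j p q where x_eq: "x = (j, p, q)" by (cases x)
    obtain k v w where y_eq: "y = (k, v, w)" by (cases y)
    have ab: "a \<noteq> b" using distinct_or_only i units(3) by auto
    \<comment> \<open>The identity matrix is attached to the identity alone, so it must not arise as a product
      of two other elements.\<close>
    have prod: "unit_mult a b x y \<noteq> (b, 0, 0)"
      using units(1,2) x y b ab by (auto simp: x_eq y_eq matrix_units_def)
    have "of_bool (unit_mult a b x y = (i, r, s)) =
        (\<Sum>t<d i. of_bool (x = (i, r, t)) * of_bool (y = (i, t, s)) :: complex)"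
      if rs: "r < d i" "s < d i" for r s
    proof -
      \<comment> \<open>Only the column index \<open>q\<close> of \<open>x\<close> can contribute.\<close>
      have "(\<Sum>t<d i. of_bool (x = (i, r, t)) * of_bool (y = (i, t, s)) :: complex) =
        (\<Sum>t<d i. if t = q then of_bool (x = (i, r, q) \<and> y = (i, q, s)) else 0)"
        by (intro sum.cong refl) (auto simp: x_eq)
      also have "\<dots> = of_bool (x = (i, r, q) \<and> y = (i, q, s))"
        using x by (auto simp: x_eq matrix_units_def)
      also have "\<dots> = of_bool (unit_mult a b x y = (i, r, s))"
        using units by (auto simp: x_eq y_eq)
      finally show ?thesis ..
    qed
    then show ?thesis
      using units prod
      by (auto simp: unit_rep_def scalar_prod_def lessThan_atLeast0 simp del: of_bool_eq_iff
          intro!: eq_matI)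
  qed
qed

text \<open>
  The change of basis in coordinates.  The exclusion of \<open>i = b\<close> avoids counting the identity
  twice, since there \<open>(i, r, s)\<close> and \<open>(b, 0, 0)\<close> are the same element.
\<close>

lemma unit_rep_sum:
  assumes "(i, r, s) \<in> matrix_units I d"
  shows "(\<Sum>x\<in>matrix_units I d. f x * unit_rep d a b i x $$ (r, s)) =
    (if i = a then \<Sum>x\<in>matrix_units I d. f x
     else f (i, r, s) + (if i \<noteq> b \<and> r = s then f (b, 0, 0) else 0))"
proof (cases "i = a")
  case True
  then show ?thesis
    using assms by (simp add: unit_rep_def matrix_units_def)
next
  case False
  let ?K = "matrix_units I d"
  have units: "(i, r, s) \<in> ?K" "(b, 0, 0) \<in> ?K"
    using assms b by (auto simp: matrix_units_def)
  have "(\<Sum>x\<in>?K. f x * unit_rep d a b i x $$ (r, s)) =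
    (\<Sum>x\<in>?K. (if x = (i, r, s) then f x else 0) +
      (if x = (b, 0, 0) then if i \<noteq> b \<and> r = s then f x else 0 else 0))"
    using assms False b by (intro sum.cong refl) (auto simp: unit_rep_def matrix_units_def)
  also have "\<dots> = f (i, r, s) + (if i \<noteq> b \<and> r = s then f (b, 0, 0) else 0)"
    using units finite_matrix_units by (simp add: sum.distrib sum.delta)
  finally show ?thesis using False by simp
qed

text \<open>
  The system is triangular: block \<open>b\<close> determines the coefficient of the identity, the other blocks
  then determine the coefficients of their matrix units, and block \<open>a\<close>, where the sum of all
  coefficients is visible, determines the remaining one.
\<close>

lemma linear_extension_unit_rep_bij:
  "bij_betw (linear_extension I d (unit_rep d a b) (unit_monoid I d a b))
    (carrier (monoid_algebra (unit_monoid I d a b))) (carrier (matrix_sum I d))"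
  (is "bij_betw ?\<Phi> ?F ?X")
proof -
  let ?K = "matrix_units I d"
  note fin = finite_matrix_units
  have carr: "?F = {f. \<forall>x. x \<notin> ?K \<longrightarrow> f x = 0}"
    using monoid_algebra_carrier_finite[of "unit_monoid I d a b"] fin
    by (simp add: unit_monoid_def)
  have entry: "?\<Phi> f i $$ (r, s) = (if i = a then \<Sum>x\<in>?K. f x
     else f (i, r, s) + (if i \<noteq> b \<and> r = s then f (b, 0, 0) else 0))"
    if "(i, r, s) \<in> ?K" for f i r s
    using that unit_rep_sum[OF that]
    by (auto simp: linear_extension_def unit_monoid_def matrix_units_def)
  have a_unit: "(a, 0, 0) \<in> ?K" and b_unit: "(b, 0, 0) \<in> ?K"
    using a b by (auto simp: matrix_units_def)
  have a_unit_only: "(a, r, s) \<in> ?K \<longleftrightarrow> r = 0 \<and> s = 0"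
    and b_unit_only: "(b, r, s) \<in> ?K \<longleftrightarrow> r = 0 \<and> s = 0" for r s
    using a b by (auto simp: matrix_units_def)
  have only: "?K = {(a, 0, 0)}" if "a = b"
    using that distinct_or_only a by (auto simp: matrix_units_def)
  have "inj_on ?\<Phi> ?F"
  proof (rule inj_onI)
    fix f g assume f: "f \<in> ?F" and g: "g \<in> ?F" and eq: "?\<Phi> f = ?\<Phi> g"
    have sums: "(\<Sum>x\<in>?K. f x) = (\<Sum>x\<in>?K. g x)"
      using entry[OF a_unit, of f] entry[OF a_unit, of g] eq by simp
    have at_b: "f (b, 0, 0) = g (b, 0, 0)"
    proof (cases "a = b")
      case True
      then show ?thesis using sums only by simp
    next
      case False
      then show ?thesis
        using entry[OF b_unit, of f] entry[OF b_unit, of g] eq by simp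
    qed
    have off_a: "f x = g x" if "x \<in> ?K - {(a, 0, 0)}" for x
    proof -
      obtain i r s where x: "x = (i, r, s)" by (cases x)
      then have "i \<noteq> a" "(i, r, s) \<in> ?K" using that a_unit_only by auto
      then show ?thesis
        using entry[of i r s f] entry[of i r s g] eq at_b by (auto simp: x split: if_splits)
    qed
    have "f (a, 0, 0) = g (a, 0, 0)"
      using sums sum.cong[OF refl off_a, of "?K - {(a, 0, 0)}"]
      by (simp add: sum.remove[OF fin a_unit])
    moreover have "f x = g x" if "x \<notin> ?K" for x
      using that f g unfolding carr by (simp del: split_paired_All)
    ultimately have "f x = g x" for x
      using off_a[of x] by blast
    then show "f = g" by (rule ext)
  qed
  moreover have "?\<Phi> ` ?F \<subseteq> ?X"
    by (auto simp: linear_extension_def finite_direct_sum_def module_mat_simps)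
  moreover have "X \<in> ?\<Phi> ` ?F" if X: "X \<in> ?X" for X
  proof -
    let ?c = "X b $$ (0, 0)"
    \<comment> \<open>The coefficients outside \<open>(a, 0, 0)\<close> come first; the last one is chosen in \<open>f\<close> to
      correct the sum.  For \<open>a = b\<close> the correction is empty, and the update gives the identity
      the required coefficient.\<close>
    define h where "h = (\<lambda>(i, r, s). if (i, r, s) \<notin> ?K then 0 else if i = b then ?c
      else X i $$ (r, s) - (if r = s then ?c else 0))"
    define f where "f = h((a, 0, 0) := X a $$ (0, 0) - (\<Sum>x\<in>?K - {(a, 0, 0)}. h x))"
    have f_in: "f \<in> ?F"
      using a_unit by (auto simp: carr f_def h_def)
    have at_b: "f (b, 0, 0) = ?c"
      using only b_unit by (cases "a = b") (auto simp: f_def h_def)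
    have total: "(\<Sum>x\<in>?K. f x) = X a $$ (0, 0)"
    proof -
      have "(\<Sum>x\<in>?K - {(a, 0, 0)}. f x) = (\<Sum>x\<in>?K - {(a, 0, 0)}. h x)"
        by (intro sum.cong) (auto simp: f_def)
      then show ?thesis
        by (simp add: sum.remove[OF fin a_unit] f_def)
    qed
    have entries: "?\<Phi> f i $$ (r, s) = X i $$ (r, s)" if "(i, r, s) \<in> ?K" for i r s
      using that a_unit_only[of r s] b_unit_only[of r s]
      by (auto simp: entry total at_b) (auto simp: f_def h_def)
    have dims: "X i \<in> carrier_mat (d i) (d i)" if "i \<in> I" for i
      using X that by (auto simp: finite_direct_sum_def module_mat_simps)
    have "?\<Phi> f i = X i" if "i \<in> I" for i
      using that entries dims[OF that]
      by (intro eq_matI) (auto simp: matrix_units_def linear_extension_def)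
    moreover have "?\<Phi> f i = X i" if "i \<notin> I" for i
    proof -
      have "X \<in> extensional I"
        using X by (simp add: finite_direct_sum_def PiE_def)
      then have "X i = undefined"
        using that by (rule extensional_arb)
      then show ?thesis
        using that by (simp add: linear_extension_def)
    qed
    ultimately have "X = ?\<Phi> f" by (metis ext)
    then show ?thesis
      using f_in by (rule image_eqI)
  qed
  ultimately show ?thesis
    by (auto simp: bij_betw_def)
qed

lemma matrix_sum_iso_monoid_algebra:
  "linear_extension I d (unit_rep d a b) (unit_monoid I d a b) \<in>
    complex_algebra_iso (monoid_algebra (unit_monoid I d a b)) (matrix_sum I d)"
  using finite_matrix_units
  by (intro linear_extension_iso unit_monoid linear_extension_unit_rep_bij)
    (auto simp: unit_monoid_def unit_rep_one unit_rep_mult, simp add: unit_rep_def)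

end

section \<open>Shapes with a single tableau\<close>

text \<open>
  Strict monotonicity forces \<open>f j\<close> to be at least \<open>Suc j\<close> counting from the bottom and at most
  \<open>Suc j\<close> counting from the top.
\<close>

lemma strict_mono_bij_eq_Suc:
  assumes bij: "bij_betw f {..<n} {1..n}"
    and mono: "\<And>j k. j < k \<Longrightarrow> k < n \<Longrightarrow> f j < f k"
    and j: "j < n"
  shows "f j = Suc j"
proof (rule antisym)
  have range: "1 \<le> f k \<and> f k \<le> n" if "k < n" for k
    using bij_betw_apply[OF bij] that by force
  show "Suc j \<le> f j"
    using j
  proof (induction j)
    case 0
    then show ?case using range by simp
  next
    case (Suc j)
    then show ?case using mono[of j "Suc j"] by simp
  qed
  have "f (n - Suc k) \<le> n - k" if "k < n" for k
    using that
  proof (induction k)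
    case 0
    then show ?case using range by simp
  next
    case (Suc k)
    have "f (n - Suc (Suc k)) < f (n - Suc k)"
      using Suc.prems by (intro mono) auto
    moreover have "f (n - Suc k) \<le> n - k"
      using Suc by simp
    ultimately show ?case by linarith
  qed
  from this[of "n - Suc j"] j show "f j \<le> Suc j" by simp
qed

text \<open>
  If the conditions on a tableau compare any two cells, and in the order in which \<open>p\<close> enumerates
  them, then the labels must follow that enumeration.
\<close>

lemma num_immaculate_total_order:
  assumes p: "bij_betw p (diagram \<alpha>) {..<sum_list \<alpha>}"
    and mono: "\<And>i j k l. (i, j) \<in> diagram \<alpha> \<Longrightarrow> (k, l) \<in> diagram \<alpha> \<Longrightarrow>
      i = k \<and> j < l \<or> i < k \<and> j = 0 \<and> l = 0 \<Longrightarrow> p (i, j) < p (k, l)"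
    and forced: "\<And>T x y. T \<in> standard_immaculate_tableaux \<alpha> \<Longrightarrow> x \<in> diagram \<alpha> \<Longrightarrow>
      y \<in> diagram \<alpha> \<Longrightarrow> p x < p y \<Longrightarrow> T x < T y"
  shows "num_immaculate \<alpha> = 1"
proof -
  let ?D = "diagram \<alpha>" and ?n = "sum_list \<alpha>"
  define T where "T = (\<lambda>x\<in>?D. Suc (p x))"
  have "bij_betw (Suc \<circ> p) ?D {1..?n}"
    using p by (rule bij_betw_trans) (auto simp: bij_betw_def image_Suc_lessThan)
  then have "bij_betw T ?D {1..?n}"
    by (rule bij_betw_cong[THEN iffD1, rotated]) (simp add: T_def)
  then have "T \<in> standard_immaculate_tableaux \<alpha>"
    using mono by (simp add: standard_immaculate_tableaux_def T_def)
  moreover have "T' = T" if T': "T' \<in> standard_immaculate_tableaux \<alpha>" for T'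
  proof -
    let ?q = "inv_into ?D p"
    have T'_bij: "bij_betw T' ?D {1..?n}" and ext: "T' \<in> extensional ?D"
      using T' by (auto simp: standard_immaculate_tableaux_def)
    have q: "bij_betw ?q {..<?n} ?D"
      using p by (rule bij_betw_inv_into)
    have q_in: "?q j \<in> ?D" and p_q: "p (?q j) = j" if "j < ?n" for j
      using that bij_betw_apply[OF q] bij_betw_inv_into_right[OF p] by auto
    have "(T' \<circ> ?q) j = Suc j" if "j < ?n" for j
    proof (rule strict_mono_bij_eq_Suc[OF bij_betw_trans[OF q T'_bij] _ that])
      fix j k assume "j < k" "k < ?n"
      then show "(T' \<circ> ?q) j < (T' \<circ> ?q) k"
        using forced[OF T', of "?q j" "?q k"] q_in p_q by simp
    qed
    then have "T' x = Suc (p x)" if "x \<in> ?D" for x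
      using that bij_betw_apply[OF p that] bij_betw_inv_into_left[OF p that] by force
    then show ?thesis
      using ext by (intro extensionalityI[of _ ?D]) (auto simp: T_def)
  qed
  ultimately have "standard_immaculate_tableaux \<alpha> = {T}" by blast
  then show ?thesis by (simp add: num_immaculate_def)
qed

lemma num_immaculate_row: "num_immaculate [n] = 1"
proof (rule num_immaculate_total_order[where p = snd])
  have "diagram [n] = {0} \<times> {..<n}" by (auto simp: diagram_def)
  then show "bij_betw snd (diagram [n]) {..<sum_list [n]}"
    by (auto simp: bij_betw_def inj_on_def)
qed (auto simp: standard_immaculate_tableaux_def diagram_def)

lemma num_immaculate_column: "num_immaculate (replicate n 1) = 1"
proof (rule num_immaculate_total_order[where p = fst])
  have "diagram (replicate n 1) = {..<n} \<times> {0}" by (auto simp: diagram_def)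
  then show "bij_betw fst (diagram (replicate n 1)) {..<sum_list (replicate n 1)}"
    by (auto simp: bij_betw_def inj_on_def sum_list_replicate)
qed (auto simp: standard_immaculate_tableaux_def diagram_def)

section \<open>The immaculate algebra\<close>

lemma length_le_sum_list:
  "\<forall>x\<in>set xs. x > 0 \<Longrightarrow> length xs \<le> sum_list xs" for xs :: "nat list"
  by (induction xs) auto

lemma finite_compositions: "finite (compositions n)"
proof (rule finite_subset)
  show "compositions n \<subseteq> {xs. set xs \<subseteq> {..n} \<and> length xs \<le> n}"
    using length_le_sum_list member_le_sum_list by (fastforce simp: compositions_def)
  show "finite {xs. set xs \<subseteq> {..n} \<and> length xs \<le> n}"
    by (simp add: finite_lists_length_le)
qed

lemma compositions_1: "compositions 1 = {[1]}"
proof -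
  have "xs = [1]" if "sum_list xs = 1" "\<forall>x\<in>set xs. x > 0" for xs :: "nat list"
    using that length_le_sum_list[of xs] by (cases xs) auto
  then show ?thesis by (auto simp: compositions_def)
qed

text \<open>
  For \<open>n = 1\<close> the row and the column are the same shape, but it is then the only composition.
\<close>

lemma two_characters_immaculate:
  assumes "n > 0"
  shows "two_characters (compositions n) num_immaculate [n] (replicate n 1)"
proof
  show "[n] \<noteq> replicate n 1 \<or> compositions n = {[n]}"
  proof (cases "n = 1")
    case True
    then show ?thesis using compositions_1 by simp
  next
    case False
    then have "length [n] \<noteq> length (replicate n (1 :: nat))" by simp
    then show ?thesis by metis
  qed
  show "[n] \<in> compositions n" "replicate n 1 \<in> compositions n"
    using assms by (auto simp: compositions_def sum_list_replicate)
qed (rule finite_compositions num_immaculate_row num_immaculate_column)+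

theorem theorem6:
  fixes n :: nat
  assumes "n > 0"
  shows "\<exists>M :: nat monoid. monoid M \<and>
           is_complex_algebra_iso (immaculate_algebra n) (monoid_algebra M)"
proof -
  interpret two_characters "compositions n" num_immaculate "[n]" "replicate n 1"
    using assms by (rule two_characters_immaculate)
  let ?M = "unit_monoid (compositions n) num_immaculate [n] (replicate n 1)"
  let ?N = "image_group to_nat ?M"
  have fin: "finite (carrier ?M)"
    using finite_matrix_units by (simp add: unit_monoid_def)
  have inj: "inj_on to_nat (carrier ?M)"
    by (rule inj_on_subset[OF inj_to_nat]) simp
  note N = monoid_image_group[OF unit_monoid inj]
  have finN: "finite (carrier ?N)"
    using fin by (simp add: image_group_carrier)
  obtain h where "h \<in> complex_algebra_iso (monoid_algebra ?N) (immaculate_algebra n)"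
    using complex_algebra_iso_trans[OF
        monoid_algebra_iso_of_monoid_iso[OF unit_monoid fin N(2) image_group_one[symmetric]]
        matrix_sum_iso_monoid_algebra]
    unfolding immaculate_algebra_def by blast
  then have "inv_into (carrier (monoid_algebra ?N)) h \<in>
      complex_algebra_iso (immaculate_algebra n) (monoid_algebra ?N)"
    using monoid_algebra_closed[OF N(1) finN] by (rule complex_algebra_iso_sym)
  then show ?thesis
    using N(1) by (auto simp: is_complex_algebra_iso_def)
qed

end
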